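(* Let $M$ be an $n$-dimensional space form $M(c)$ of constant sectional curvature $c$, or an $n$-dimensional hypersurface of Euclidean space $E^{n+1}$, with $n\ge 3$. Let $\alpha=\alpha(s)$ be a unit speed non-degenerate curve in $M$ with Frenet vectors $\{v_1,\dots,v_n\}$ and harmonic curvatures $\{H_1,\dots,H_{n-2}\}$. If $\alpha$ is an LC helix, then $\sum_{i=1}^{n-2}H_i^2$ is constant along $\alpha$.
   Context: Let $\nabla$ be the Levi-Civita connection of $M$ and $\langle\cdot,\cdot\rangle$ its metric; the curve is defined on an open interval $I\subset\mathbb{R}$. A non-degenerate ($n$-th order regular) curve $\alpha:I\to M$ is a smooth curve with an orthonormal Frenet frame $\{v_1,\dots,v_n\}$ of vector fields along $\alpha$ tangent to $M$, where $v_1$ is the unit tangent, and with nowhere vanishing curvatures $k_1,\dots,k_{n-1}$ (also written $\kappa_i$), such that $\nabla_{v_1}v_1=k_1v_2$, $\nabla_{v_1}v_i=-k_{i-1}v_{i-1}+k_iv_{i+1}$ for $1<i<n$, and $\nabla_{v_1}v_n=-k_{n-1}v_{n-1}$. For a function $f$ along $\alpha$, $v_1[f]$ denotes the derivative of $f$ with respect to arc length. Harmonic curvatures: $H_0=0$, $H_1=\dfrac{k_1}{k_2}$, and $H_i=\dfrac{1}{k_{i+1}}\left(v_1[H_{i-1}]+k_iH_{i-2}\right)$ for $1<i\le n-2$. A vector field $X$ along $\alpha$ tangent to $M$ is LC parallel (parallel in the sense of Levi-Civita) if $\nabla_{v_1}X=0$. The curve $\alpha$ is an LC helix if there is a unit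 LC parallel vector field $X$ along $\alpha$ such that $\langle v_1,X\rangle=\cos\varphi$ is constant along $\alpha$; such an $X$ is called an axis of the LC helix. *)

theory Defs
  imports "HOL-Analysis.Analysis"
begin

section \<open>Smooth maps between normed spaces\<close>

text \<open>Meant for open \<open>S\<close>, where this is the class \<open>C\<^sup>k\<close>.\<close>

primrec ck_on :: "nat \<Rightarrow> 'a::real_normed_vector set \<Rightarrow> ('a \<Rightarrow> 'b::real_normed_vector) \<Rightarrow> bool" where
  "ck_on 0 S f \<longleftrightarrow> continuous_on S f"
| "ck_on (Suc k) S f \<longleftrightarrow> (\<forall>x\<in>S. f differentiable (at x)) \<and>
     (\<forall>v. ck_on k S (\<lambda>x. frechet_derivative f (at x) v))"

definition smooth_on :: "'a::real_normed_vector set \<Rightarrow> ('a \<Rightarrow> 'b::real_normed_vector) \<Rightarrow> bool" where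
  "smooth_on S f \<longleftrightarrow> (\<forall>k. ck_on k S f)"

definition partial_deriv :: "'n::finite \<Rightarrow> (real ^ 'n \<Rightarrow> 'b::real_normed_vector) \<Rightarrow> real ^ 'n \<Rightarrow> 'b" where
  "partial_deriv i f x = frechet_derivative f (at x) (axis i 1)"


section \<open>Smooth and Riemannian manifolds\<close>

text \<open>A chart is a pair of its domain and its coordinate map. Only the values of the coordinate map
  on the domain matter.\<close>

type_synonym ('a, 'n) chart = "'a set \<times> ('a \<Rightarrow> real ^ 'n)"

abbreviation cdom :: "('a, 'n) chart \<Rightarrow> 'a set" where
  "cdom c \<equiv> fst c"

abbreviation coord :: "('a, 'n) chart \<Rightarrow> 'a \<Rightarrow> real ^ 'n" where
  "coord c \<equiv> snd c"

abbreviation cimg :: "('a, 'n) chart \<Rightarrow> (real ^ 'n) set" where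
  "cimg c \<equiv> coord c ` cdom c"

definition param :: "('a, 'n) chart \<Rightarrow> real ^ 'n \<Rightarrow> 'a" where
  "param c = inv_into (cdom c) (coord c)"

definition transition :: "('a, 'n) chart \<Rightarrow> ('a, 'n) chart \<Rightarrow> real ^ 'n \<Rightarrow> real ^ 'n" where
  "transition c d = coord d \<circ> param c"

definition smooth_manifold :: "'a topology \<Rightarrow> ('a, 'n::finite) chart set \<Rightarrow> bool" where
  "smooth_manifold M \<A> \<longleftrightarrow>
     Hausdorff_space M \<and> second_countable M \<and> topspace M = (\<Union>c\<in>\<A>. cdom c) \<and>
     (\<forall>c\<in>\<A>. openin M (cdom c) \<and> open (cimg c) \<and>
        homeomorphic_map (subtopology M (cdom c)) (top_of_set (cimg c)) (coord c)) \<and>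
     (\<forall>c\<in>\<A>. \<forall>d\<in>\<A>. smooth_on (coord c ` (cdom c \<inter> cdom d)) (transition c d))"

text \<open>A metric tensor is given by its coordinate matrices: \<open>g c x\<close> is the matrix
  \<open>(g\<^sub>i\<^sub>j)\<close> at the point with coordinates \<open>x\<close> in the chart \<open>c\<close>.\<close>

type_synonym ('a, 'n) metric = "('a, 'n) chart \<Rightarrow> real ^ 'n \<Rightarrow> real ^ 'n ^ 'n"

definition metric_inner :: "real ^ 'n ^ 'n::finite \<Rightarrow> real ^ 'n \<Rightarrow> real ^ 'n \<Rightarrow> real" where
  "metric_inner G u w = u \<bullet> (G *v w)"

definition riemannian_manifold ::
  "'a topology \<Rightarrow> ('a, 'n::finite) chart set \<Rightarrow> ('a, 'n) metric \<Rightarrow> bool" where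
  "riemannian_manifold M \<A> g \<longleftrightarrow>
     smooth_manifold M \<A> \<and>
     (\<forall>c\<in>\<A>. smooth_on (cimg c) (g c)) \<and>
     (\<forall>c\<in>\<A>. \<forall>x\<in>cimg c. transpose (g c x) = g c x \<and>
        (\<forall>u. u \<noteq> 0 \<longrightarrow> metric_inner (g c x) u u > 0)) \<and>
     (\<forall>c\<in>\<A>. \<forall>d\<in>\<A>. \<forall>p\<in>cdom c \<inter> cdom d. \<forall>u w.
        metric_inner (g c (coord c p)) u w =
        metric_inner (g d (coord d p))
          (frechet_derivative (transition c d) (at (coord c p)) u)
          (frechet_derivative (transition c d) (at (coord c p)) w))"


section \<open>Levi-Civita connection and curvature\<close>

text \<open>In terms of the coordinate matrix \<open>G\<close> of the metric in a chart, \<open>christoffel G x k i j\<close> is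
  \<open>\<Gamma>\<^sup>k\<^sub>i\<^sub>j\<close>, that is, \<open>\<nabla>\<^bsub>\<partial>i\<^esub> \<partial>j = (\<Sum>k. \<Gamma>\<^sup>k\<^sub>i\<^sub>j \<partial>k)\<close>.\<close>

definition christoffel ::
  "(real ^ 'n \<Rightarrow> real ^ 'n ^ 'n) \<Rightarrow> real ^ 'n \<Rightarrow> 'n::finite \<Rightarrow> 'n \<Rightarrow> 'n \<Rightarrow> real" where
  "christoffel G x k i j = (1 / 2) * (\<Sum>l\<in>UNIV. matrix_inv (G x) $ k $ l *
     (partial_deriv i (\<lambda>y. G y $ j $ l) x + partial_deriv j (\<lambda>y. G y $ i $ l) x
      - partial_deriv l (\<lambda>y. G y $ i $ j) x))"

text \<open>\<open>riemann G x l i j k\<close> is the component along \<open>\<partial>l\<close> of \<open>R(\<partial>i, \<partial>j) \<partial>k\<close>, where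
  \<open>R(X, Y) Z = \<nabla>\<^sub>X \<nabla>\<^sub>Y Z - \<nabla>\<^sub>Y \<nabla>\<^sub>X Z - \<nabla>\<^bsub>[X, Y]\<^esub> Z\<close>.\<close>

definition riemann ::
  "(real ^ 'n \<Rightarrow> real ^ 'n ^ 'n) \<Rightarrow> real ^ 'n \<Rightarrow> 'n::finite \<Rightarrow> 'n \<Rightarrow> 'n \<Rightarrow> 'n \<Rightarrow> real" where
  "riemann G x l i j k =
     partial_deriv i (\<lambda>y. christoffel G y l j k) x - partial_deriv j (\<lambda>y. christoffel G y l i k) x +
     (\<Sum>m\<in>UNIV. christoffel G x l i m * christoffel G x m j k -
                christoffel G x l j m * christoffel G x m i k)"

definition riemann_op ::
  "(real ^ 'n \<Rightarrow> real ^ 'n ^ 'n) \<Rightarrow> real ^ 'n \<Rightarrow> real ^ 'n \<Rightarrow> real ^ 'n \<Rightarrow> real ^ 'n \<Rightarrow> real ^ 'n::finite" where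
  "riemann_op G x u w z =
     (\<chi> l. \<Sum>i\<in>UNIV. \<Sum>j\<in>UNIV. \<Sum>k\<in>UNIV. riemann G x l i j k * u $ i * w $ j * z $ k)"

definition sectional_curvature ::
  "(real ^ 'n \<Rightarrow> real ^ 'n ^ 'n) \<Rightarrow> real ^ 'n \<Rightarrow> real ^ 'n \<Rightarrow> real ^ 'n::finite \<Rightarrow> real" where
  "sectional_curvature G x u w = metric_inner (G x) (riemann_op G x u w w) u /
     (metric_inner (G x) u u * metric_inner (G x) w w - (metric_inner (G x) u w)\<^sup>2)"


section \<open>Curves and vector fields along curves\<close>

definition smooth_curve ::
  "'a topology \<Rightarrow> ('a, 'n::finite) chart set \<Rightarrow> real set \<Rightarrow> (real \<Rightarrow> 'a) \<Rightarrow> bool" where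
  "smooth_curve M \<A> I \<alpha> \<longleftrightarrow>
     open I \<and> is_interval I \<and> I \<noteq> {} \<and> continuous_map (top_of_set I) M \<alpha> \<and>
     (\<forall>c\<in>\<A>. smooth_on {s \<in> I. \<alpha> s \<in> cdom c} (coord c \<circ> \<alpha>))"

text \<open>A vector field tangent to the manifold along a curve \<open>\<alpha>\<close> is given by its components
  \<open>V c s\<close> in the chart \<open>c\<close> at \<open>\<alpha> s\<close>, which transform by the differentials of the transition maps.
  \<open>V c s\<close> is meaningful only if \<open>\<alpha> s\<close> lies in the domain of \<open>c\<close>.\<close>

type_synonym ('a, 'n) field_along = "('a, 'n) chart \<Rightarrow> real \<Rightarrow> real ^ 'n"

definition vector_field_along ::
  "('a, 'n::finite) chart set \<Rightarrow> real set \<Rightarrow> (real \<Rightarrow> 'a) \<Rightarrow> ('a, 'n) field_along \<Rightarrow> bool" where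
  "vector_field_along \<A> I \<alpha> V \<longleftrightarrow>
     (\<forall>c\<in>\<A>. smooth_on {s \<in> I. \<alpha> s \<in> cdom c} (V c)) \<and>
     (\<forall>c\<in>\<A>. \<forall>d\<in>\<A>. \<forall>s\<in>I. \<alpha> s \<in> cdom c \<inter> cdom d \<longrightarrow>
        V d s = frechet_derivative (transition c d) (at (coord c (\<alpha> s))) (V c s))"

definition field_eq ::
  "('a, 'n::finite) chart set \<Rightarrow> real set \<Rightarrow> (real \<Rightarrow> 'a) \<Rightarrow>
   ('a, 'n) field_along \<Rightarrow> ('a, 'n) field_along \<Rightarrow> bool" where
  "field_eq \<A> I \<alpha> V W \<longleftrightarrow> (\<forall>c\<in>\<A>. \<forall>s\<in>I. \<alpha> s \<in> cdom c \<longrightarrow> V c s = W c s)"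

definition velocity :: "(real \<Rightarrow> 'a) \<Rightarrow> ('a, 'n::finite) field_along" where
  "velocity \<alpha> c s = vector_derivative (coord c \<circ> \<alpha>) (at s)"

text \<open>The inner product of two fields along \<open>\<alpha>\<close>, required to be \<open>r s\<close> at each \<open>s\<close>. The
  transformation laws make the inner product independent of the chart.\<close>

definition field_inner_eq ::
  "('a, 'n::finite) chart set \<Rightarrow> ('a, 'n) metric \<Rightarrow> real set \<Rightarrow> (real \<Rightarrow> 'a) \<Rightarrow>
   ('a, 'n) field_along \<Rightarrow> ('a, 'n) field_along \<Rightarrow> (real \<Rightarrow> real) \<Rightarrow> bool" where
  "field_inner_eq \<A> g I \<alpha> V W r \<longleftrightarrow>
     (\<forall>c\<in>\<A>. \<forall>s\<in>I. \<alpha> s \<in> cdom c \<longrightarrow> metric_inner (g c (coord c (\<alpha> s))) (V c s) (W c s) = r s)"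

text \<open>The Levi-Civita covariant derivative of a field along \<open>\<alpha>\<close> in the direction \<open>\<alpha>'\<close>.\<close>

definition cov_deriv ::
  "('a, 'n) metric \<Rightarrow> (real \<Rightarrow> 'a) \<Rightarrow> ('a, 'n) field_along \<Rightarrow> ('a, 'n::finite) field_along" where
  "cov_deriv g \<alpha> V c s = vector_derivative (V c) (at s) +
     (\<chi> k. \<Sum>i\<in>UNIV. \<Sum>j\<in>UNIV.
        christoffel (g c) (coord c (\<alpha> s)) k i j * velocity \<alpha> c s $ i * V c s $ j)"


section \<open>Space forms and hypersurfaces\<close>

definition geodesically_complete ::
  "'a topology \<Rightarrow> ('a, 'n::finite) chart set \<Rightarrow> ('a, 'n) metric \<Rightarrow> bool" where
  "geodesically_complete M \<A> g \<longleftrightarrow>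
     (\<forall>c\<in>\<A>. \<forall>p\<in>cdom c. \<forall>u. \<exists>\<gamma>. smooth_curve M \<A> UNIV \<gamma> \<and> \<gamma> 0 = p \<and> velocity \<gamma> c 0 = u \<and>
        field_eq \<A> UNIV \<gamma> (cov_deriv g \<gamma> (velocity \<gamma>)) (\<lambda>c s. 0))"

definition space_form ::
  "'a topology \<Rightarrow> ('a, 'n::finite) chart set \<Rightarrow> ('a, 'n) metric \<Rightarrow> real \<Rightarrow> bool" where
  "space_form M \<A> g \<kappa> \<longleftrightarrow>
     riemannian_manifold M \<A> g \<and> connected_space M \<and> geodesically_complete M \<A> g \<and>
     (\<forall>c\<in>\<A>. \<forall>x\<in>cimg c. \<forall>u w. u \<noteq> w \<and> independent {u, w} \<longrightarrow>
        sectional_curvature (g c) x u w = \<kappa>)"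

text \<open>\<open>f\<close> is the immersion (the inclusion, if the manifold is a subset of Euclidean space) and
  \<open>g\<close> the induced metric. The index type \<open>'n option\<close> has one element more than \<open>'n\<close>.\<close>

definition euclidean_hypersurface ::
  "'a topology \<Rightarrow> ('a, 'n::finite) chart set \<Rightarrow> ('a, 'n) metric \<Rightarrow> ('a \<Rightarrow> real ^ 'n option) \<Rightarrow> bool" where
  "euclidean_hypersurface M \<A> g f \<longleftrightarrow>
     riemannian_manifold M \<A> g \<and>
     (\<forall>c\<in>\<A>. smooth_on (cimg c) (f \<circ> param c) \<and>
        (\<forall>x\<in>cimg c. inj (frechet_derivative (f \<circ> param c) (at x)) \<and>
           (\<forall>i j. g c x $ i $ j =
              partial_deriv i (f \<circ> param c) x \<bullet> partial_deriv j (f \<circ> param c) x)))"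


section \<open>Non-degenerate curves and helices\<close>

definition unit_speed_curve ::
  "'a topology \<Rightarrow> ('a, 'n::finite) chart set \<Rightarrow> ('a, 'n) metric \<Rightarrow> real set \<Rightarrow> (real \<Rightarrow> 'a) \<Rightarrow> bool" where
  "unit_speed_curve M \<A> g I \<alpha> \<longleftrightarrow>
     smooth_curve M \<A> I \<alpha> \<and> field_inner_eq \<A> g I \<alpha> (velocity \<alpha>) (velocity \<alpha>) (\<lambda>s. 1)"

text \<open>From here on, curves have unit speed: the unit tangent is \<open>\<alpha>'\<close>, the derivative \<open>v\<^sub>1[f]\<close> is
  \<open>f'\<close>, and the covariant derivative in the direction \<open>v\<^sub>1\<close> is \<^const>\<open>cov_deriv\<close>. The frame and the
  curvatures are indexed from 1.\<close>

definition nondegenerate_curve ::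
  "'a topology \<Rightarrow> ('a, 'n::finite) chart set \<Rightarrow> ('a, 'n) metric \<Rightarrow> real set \<Rightarrow> (real \<Rightarrow> 'a) \<Rightarrow>
   (nat \<Rightarrow> ('a, 'n) field_along) \<Rightarrow> (nat \<Rightarrow> real \<Rightarrow> real) \<Rightarrow> bool" where
  "nondegenerate_curve M \<A> g I \<alpha> v k \<longleftrightarrow>
     unit_speed_curve M \<A> g I \<alpha> \<and>
     (\<forall>i\<in>{1..CARD('n)}. vector_field_along \<A> I \<alpha> (v i)) \<and>
     (\<forall>i\<in>{1..CARD('n)}. \<forall>j\<in>{1..CARD('n)}.
        field_inner_eq \<A> g I \<alpha> (v i) (v j) (\<lambda>s. if i = j then 1 else 0)) \<and>
     field_eq \<A> I \<alpha> (v 1) (velocity \<alpha>) \<and>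
     (\<forall>i\<in>{1..CARD('n) - 1}. \<forall>s\<in>I. k i s \<noteq> 0) \<and>
     field_eq \<A> I \<alpha> (cov_deriv g \<alpha> (v 1)) (\<lambda>c s. k 1 s *\<^sub>R v 2 c s) \<and>
     (\<forall>i. 1 < i \<and> i < CARD('n) \<longrightarrow>
        field_eq \<A> I \<alpha> (cov_deriv g \<alpha> (v i))
          (\<lambda>c s. - k (i - 1) s *\<^sub>R v (i - 1) c s + k i s *\<^sub>R v (i + 1) c s)) \<and>
     field_eq \<A> I \<alpha> (cov_deriv g \<alpha> (v (CARD('n))))
       (\<lambda>c s. - k (CARD('n) - 1) s *\<^sub>R v (CARD('n) - 1) c s)"

fun harmonic_curvature :: "(nat \<Rightarrow> real \<Rightarrow> real) \<Rightarrow> nat \<Rightarrow> real \<Rightarrow> real" where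
  "harmonic_curvature k 0 = (\<lambda>s. 0)"
| "harmonic_curvature k (Suc 0) = (\<lambda>s. k 1 s / k 2 s)"
| "harmonic_curvature k (Suc (Suc i)) = (\<lambda>s. 1 / k (i + 3) s *
     (deriv (harmonic_curvature k (Suc i)) s + k (i + 2) s * harmonic_curvature k i s))"

definition lc_parallel ::
  "('a, 'n::finite) chart set \<Rightarrow> ('a, 'n) metric \<Rightarrow> real set \<Rightarrow> (real \<Rightarrow> 'a) \<Rightarrow> ('a, 'n) field_along \<Rightarrow> bool" where
  "lc_parallel \<A> g I \<alpha> X \<longleftrightarrow>
     vector_field_along \<A> I \<alpha> X \<and> field_eq \<A> I \<alpha> (cov_deriv g \<alpha> X) (\<lambda>c s. 0)"

definition lc_helix_axis ::
  "('a, 'n::finite) chart set \<Rightarrow> ('a, 'n) metric \<Rightarrow> real set \<Rightarrow> (real \<Rightarrow> 'a) \<Rightarrow> ('a, 'n) field_along \<Rightarrow> bool" where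
  "lc_helix_axis \<A> g I \<alpha> X \<longleftrightarrow>
     lc_parallel \<A> g I \<alpha> X \<and> field_inner_eq \<A> g I \<alpha> X X (\<lambda>s. 1) \<and>
     (\<exists>\<phi>. field_inner_eq \<A> g I \<alpha> (velocity \<alpha>) X (\<lambda>s. cos \<phi>))"

definition lc_helix ::
  "('a, 'n::finite) chart set \<Rightarrow> ('a, 'n) metric \<Rightarrow> real set \<Rightarrow> (real \<Rightarrow> 'a) \<Rightarrow> bool" where
  "lc_helix \<A> g I \<alpha> \<longleftrightarrow> (\<exists>X. lc_helix_axis \<A> g I \<alpha> X)"


section \<open>The connection coefficients are those of the Levi-Civita connection\<close>

lemma partial_deriv_cong_open:
  assumes "open S" "x \<in> S" "\<And>y. y \<in> S \<Longrightarrow> f y = h y"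
  shows "partial_deriv i f x = partial_deriv i h x"
proof -
  have "(f has_derivative D) (at x) \<longleftrightarrow> (h has_derivative D) (at x)" for D
    using assms by (metis has_derivative_transform_within_open)
  then show ?thesis by (simp add: partial_deriv_def frechet_derivative_def)
qed

lemma partial_deriv_sym:
  assumes "open S" "x \<in> S" "\<And>y. y \<in> S \<Longrightarrow> transpose (G y) = G y"
  shows "partial_deriv l (\<lambda>y. G y $ i $ j) x = partial_deriv l (\<lambda>y. G y $ j $ i) x"
proof (rule partial_deriv_cong_open[OF assms(1,2)])
  fix y assume "y \<in> S"
  have "G y $ i $ j = transpose (G y) $ j $ i" by (simp add: transpose_def)
  then show "G y $ i $ j = G y $ j $ i" by (simp only: assms(3)[OF \<open>y \<in> S\<close>])
qed

lemma christoffel_torsion_free: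
  assumes "open S" "x \<in> S" "\<And>y. y \<in> S \<Longrightarrow> transpose (G y) = G y"
  shows "christoffel G x k i j = christoffel G x k j i"
proof -
  have "partial_deriv l (\<lambda>y. G y $ i $ j) x = partial_deriv l (\<lambda>y. G y $ j $ i) x" for l
    by (rule partial_deriv_sym[OF assms])
  then show ?thesis by (simp only: christoffel_def add.commute[of "partial_deriv i _ _"])
qed

lemma christoffel_metric:
  assumes "open S" "x \<in> S" "\<And>y. y \<in> S \<Longrightarrow> transpose (G y) = G y" and inv: "invertible (G x)"
  shows "partial_deriv k (\<lambda>y. G y $ i $ j) x =
    (\<Sum>l\<in>UNIV. G x $ l $ j * christoffel G x l k i) + (\<Sum>l\<in>UNIV. G x $ i $ l * christoffel G x l k j)"
proof -
  have sym: "partial_deriv l (\<lambda>y. G y $ i $ j) x = partial_deriv l (\<lambda>y. G y $ j $ i) x" for l i j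
    by (rule partial_deriv_sym[OF assms(1-3)])
  have symx: "G x $ a $ b = G x $ b $ a" for a b
  proof -
    have "G x $ a $ b = transpose (G x) $ b $ a" by (simp add: transpose_def)
    then show ?thesis by (simp only: assms(3)[OF assms(2)])
  qed
  have GI: "(\<Sum>l\<in>UNIV. G x $ a $ l * matrix_inv (G x) $ l $ m) = (if a = m then 1 else 0)" for a m
  proof -
    have "G x ** matrix_inv (G x) = mat 1"
      using someI_ex[OF inv[unfolded invertible_def]] by (simp add: matrix_inv_def)
    then have "(G x ** matrix_inv (G x)) $ a $ m = mat 1 $ a $ m" by (simp only:)
    then show ?thesis by (simp add: matrix_matrix_mult_def mat_def)
  qed
  have low: "(\<Sum>l\<in>UNIV. G x $ a $ l * christoffel G x l p q) =
     (1/2) * (partial_deriv p (\<lambda>y. G y $ q $ a) x + partial_deriv q (\<lambda>y. G y $ p $ a) x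
       - partial_deriv a (\<lambda>y. G y $ p $ q) x)" for a p q
  proof -
    define T where "T m = partial_deriv p (\<lambda>y. G y $ q $ m) x + partial_deriv q (\<lambda>y. G y $ p $ m) x
       - partial_deriv m (\<lambda>y. G y $ p $ q) x" for m
    have "(\<Sum>l\<in>UNIV. G x $ a $ l * christoffel G x l p q) =
       (\<Sum>l\<in>UNIV. \<Sum>m\<in>UNIV. (1/2) * (G x $ a $ l * matrix_inv (G x) $ l $ m * T m))"
      by (simp add: christoffel_def T_def sum_distrib_left mult_ac)
    also have "\<dots> = (\<Sum>m\<in>UNIV. (1/2) * ((\<Sum>l\<in>UNIV. G x $ a $ l * matrix_inv (G x) $ l $ m) * T m))"
      by (subst sum.swap) (simp add: sum_distrib_left sum_distrib_right)
    also have "\<dots> = (1/2) * T a"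
      by (simp add: GI if_distrib[of "\<lambda>z. z * _"] cong: if_cong flip: sum_divide_distrib)
    finally show ?thesis by (simp add: T_def)
  qed
  have "(\<Sum>l\<in>UNIV. G x $ l $ j * christoffel G x l k i) = (\<Sum>l\<in>UNIV. G x $ j $ l * christoffel G x l k i)"
    by (rule sum.cong) (simp_all only: symx[of _ j])
  then show ?thesis
    using sym[of k i j] sym[of i k j] sym[of j k i] by (simp only: low) (simp add: field_simps)
qed

end

theory Submission
  imports Defs
begin

text \<open>Let \<open>X\<close> be an axis, \<open>\<langle>v\<^sub>1, X\<rangle> = cos \<phi>\<close>, and let \<open>a\<^sub>i = \<langle>v\<^sub>i, X\<rangle>\<close>. The Levi-Civita connection is
  metric and \<open>X\<close> is parallel, so \<open>a\<^sub>i'\<close> is the inner product of \<open>X\<close> with the covariant derivative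
  of \<open>v\<^sub>i\<close> (lemma \<open>cov_deriv_metric\<close>), and the Frenet equations become
  \<open>a\<^sub>1' = k\<^sub>1 a\<^sub>2\<close> and \<open>a\<^sub>i' = - k\<^bsub>i-1\<^esub> a\<^bsub>i-1\<^esub> + k\<^sub>i a\<^bsub>i+1\<^esub>\<close> for \<open>1 < i < n\<close>. As \<open>a\<^sub>1\<close> is constant and
  the curvatures do not vanish, each equation determines the next coefficient: \<open>a\<^sub>2 = 0\<close>,
  \<open>a\<^sub>3 = (k\<^sub>1 / k\<^sub>2) cos \<phi>\<close>, and so on. Up to the factor \<open>cos \<phi>\<close> this is the recursion that defines
  the harmonic curvatures, so \<open>a\<^bsub>i+2\<^esub> = H\<^sub>i cos \<phi>\<close> (lemma \<open>frenet_coefficients_harmonic_curvature\<close>).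

  The frame is an orthonormal basis and \<open>X\<close> is a unit field, so the squares of the \<open>a\<^sub>i\<close> add up to
  \<open>1\<close> (lemma \<open>metric_inner_parseval\<close>). This says \<open>(cos \<phi>)\<^sup>2 (1 + (\<Sum>i. H\<^sub>i\<^sup>2)) = 1\<close>. Hence
  \<open>cos \<phi> \<noteq> 0\<close>, and the sum is the constant \<open>1 / (cos \<phi>)\<^sup>2 - 1\<close>.

  Each point of the curve can be treated in a single chart around it: the harmonic curvatures and the
  angle \<open>\<phi>\<close> do not refer to charts, so the constant is the same at every parameter.\<close>

section \<open>The inner product of a metric matrix\<close>

lemma metric_inner_add_left: "metric_inner G (u + u') w = metric_inner G u w + metric_inner G u' w"
  by (simp add: metric_inner_def inner_add_left)

lemma metric_inner_scaleR_left: "metric_inner G (a *\<^sub>R u) w = a * metric_inner G u w"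
  by (simp add: metric_inner_def)

lemma metric_inner_add_right: "metric_inner G u (w + w') = metric_inner G u w + metric_inner G u w'"
  by (simp add: metric_inner_def inner_add_right matrix_vector_right_distrib)

lemma metric_inner_scaleR_right: "metric_inner G u (a *\<^sub>R w) = a * metric_inner G u w"
  by (simp add: metric_inner_def matrix_vector_mult_scaleR)

lemma metric_inner_zero_right: "metric_inner G u 0 = 0"
  by (simp add: metric_inner_def)

lemma metric_inner_zero_left: "metric_inner G 0 w = 0"
  by (simp add: metric_inner_def)

lemma metric_inner_sum_left: "metric_inner G (\<Sum>i\<in>A. f i) w = (\<Sum>i\<in>A. metric_inner G (f i) w)"
  by (simp add: metric_inner_def inner_sum_left)

lemma metric_inner_sum_right: "metric_inner G u (\<Sum>i\<in>A. f i) = (\<Sum>i\<in>A. metric_inner G u (f i))"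
  by (induction A rule: infinite_finite_induct)
    (simp_all add: metric_inner_zero_right metric_inner_add_right)

lemma metric_inner_components:
  "metric_inner G u w = (\<Sum>i\<in>UNIV. \<Sum>j\<in>UNIV. G $ i $ j * u $ i * w $ j)"
  by (simp add: metric_inner_def inner_vec_def matrix_vector_mult_def sum_distrib_left mult_ac)

lemma metric_inner_commute:
  assumes "transpose G = G"
  shows "metric_inner G u w = metric_inner G w u"
proof -
  have "u v* G = G *v u" using transpose_matrix_vector[of G u] assms by simp
  then have "u \<bullet> (G *v w) = (G *v u) \<bullet> w" using dot_lmul_matrix[of u G w] by simp
  then show ?thesis unfolding metric_inner_def by (simp only: inner_commute)
qed

text \<open>Orthonormal vectors are linearly independent, so as many of them as the dimension form a
  basis, and the coefficients of a vector in it are its inner products with the basis vectors.\<close>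

lemma metric_inner_parseval:
  fixes G :: "real ^ 'n ^ 'n::finite"
  assumes sym: "transpose G = G"
    and ortho: "\<And>i j. i \<in> J \<Longrightarrow> j \<in> J \<Longrightarrow> metric_inner G (e i) (e j) = (if i = j then 1 else 0)"
    and card: "finite J" "card J = CARD('n)"
  shows "metric_inner G x x = (\<Sum>i\<in>J. (metric_inner G (e i) x)\<^sup>2)"
proof -
  have inj: "inj_on e J"
  proof (rule inj_onI)
    fix i j assume "i \<in> J" "j \<in> J" "e i = e j"
    then show "i = j" using ortho[of i j] ortho[of j j] by (metis zero_neq_one)
  qed
  have indep: "independent (e ` J)"
  proof (rule independent_if_scalars_zero)
    show "finite (e ` J)" using card by simp
    fix f y assume sum: "(\<Sum>y\<in>e ` J. f y *\<^sub>R y) = 0" and "y \<in> e ` J"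
    then obtain j where j: "j \<in> J" "y = e j" by blast
    have "(\<Sum>i\<in>J. f (e i) *\<^sub>R e i) = 0" using sum by (simp add: sum.reindex[OF inj])
    then have "0 = metric_inner G (\<Sum>i\<in>J. f (e i) *\<^sub>R e i) (e j)"
      by (simp add: metric_inner_zero_left)
    also have "\<dots> = (\<Sum>i\<in>J. if i = j then f (e i) else 0)"
      unfolding metric_inner_sum_left metric_inner_scaleR_left
      by (rule sum.cong) (simp_all add: ortho j)
    also have "\<dots> = f y" using j card by simp
    finally show "f y = 0" by simp
  qed
  have "span (e ` J) = UNIV"
  proof -
    have "UNIV \<subseteq> span (e ` J)"
      by (rule card_ge_dim_independent[OF subset_UNIV indep]) (simp add: card_image[OF inj] card)
    then show ?thesis by blast
  qed
  then have "x \<in> span (e ` J)" by simp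
  then obtain f where "x = (\<Sum>y\<in>e ` J. f y *\<^sub>R y)"
    using card by (auto simp: span_finite)
  then have x: "x = (\<Sum>i\<in>J. f (e i) *\<^sub>R e i)" by (simp add: sum.reindex[OF inj])
  have left: "metric_inner G (e j) x = f (e j)" if "j \<in> J" for j
  proof -
    have "metric_inner G (e j) x = (\<Sum>i\<in>J. if i = j then f (e i) else 0)"
      unfolding x metric_inner_sum_right metric_inner_scaleR_right
      by (rule sum.cong) (simp_all add: ortho that)
    then show ?thesis using that card by simp
  qed
  have "metric_inner G x x = metric_inner G x (\<Sum>i\<in>J. f (e i) *\<^sub>R e i)" using x by simp
  also have "\<dots> = (\<Sum>i\<in>J. f (e i) * metric_inner G x (e i))"
    by (simp add: metric_inner_sum_right metric_inner_scaleR_right)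
  finally show ?thesis
    by (simp add: metric_inner_commute[OF sym, of x "e _"] left power2_eq_square)
qed

section \<open>Metric compatibility along a curve\<close>

lemma smooth_on_imp_differentiable:
  assumes "smooth_on S f" "x \<in> S"
  shows "f differentiable (at x)"
proof -
  have "ck_on (Suc 0) S f" using assms(1) unfolding smooth_on_def by blast
  then show ?thesis using assms(2) by simp
qed

lemma chain_rule_partial_deriv:
  fixes f :: "real ^ 'n::finite \<Rightarrow> real"
  assumes f: "f differentiable (at (x s))" and x: "(x has_vector_derivative x') (at s)"
  shows "((\<lambda>t. f (x t)) has_real_derivative (\<Sum>k\<in>UNIV. x' $ k * partial_deriv k f (x s))) (at s)"
proof -
  let ?D = "frechet_derivative f (at (x s))"
  have D: "(f has_derivative ?D) (at (x s))"
    using f frechet_derivative_works by blast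
  have lin: "linear ?D" using D has_derivative_linear by blast
  have "?D x' = ?D (\<Sum>k\<in>UNIV. x' $ k *\<^sub>R axis k 1)"
    using basis_expansion[of x'] by (simp add: scalar_mult_eq_scaleR)
  also have "\<dots> = (\<Sum>k\<in>UNIV. x' $ k * partial_deriv k f (x s))"
    by (simp add: linear_sum[OF lin] linear_cmul[OF lin] partial_deriv_def)
  finally have "?D x' = (\<Sum>k\<in>UNIV. x' $ k * partial_deriv k f (x s))" .
  moreover have "((f \<circ> x) has_vector_derivative ?D x') (at s)"
    by (rule vector_derivative_diff_chain_within[OF x])
      (rule has_derivative_at_withinI[OF D])
  ultimately show ?thesis
    by (simp add: has_real_derivative_iff_has_vector_derivative o_def)
qed

lemma matrix_component_differentiable:
  fixes G :: "real ^ 'n \<Rightarrow> real ^ 'n ^ 'n::finite"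
  assumes "G differentiable (at x)"
  shows "(\<lambda>y. G y $ i $ j) differentiable (at x)"
proof -
  have bl: "bounded_linear (\<lambda>A::real ^ 'n ^ 'n. A $ i $ j)"
    using bounded_linear_compose[OF bounded_linear_vec_nth bounded_linear_vec_nth] .
  obtain D where "(G has_derivative D) (at x)" using assms differentiable_def by blast
  from bounded_linear.has_derivative[OF bl this]
  show ?thesis unfolding differentiable_def by blast
qed

lemma invertible_if_pos_def:
  fixes G :: "real ^ 'n ^ 'n::finite"
  assumes "\<And>u. u \<noteq> 0 \<Longrightarrow> metric_inner G u u > 0"
  shows "invertible G"
proof -
  have "G *v u \<noteq> 0" if "u \<noteq> 0" for u
    using assms[OF that] by (auto simp: metric_inner_def)
  then show ?thesis
    by (metis invertible_left_inverse matrix_left_invertible_ker)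
qed

text \<open>By the product rule and the chain rule, the derivative consists of the terms with \<open>V'\<close> and
  \<open>W'\<close> and of one term with the derivatives of the coefficients of \<open>G\<close> along the curve. The identity
  \<open>\<partial>\<^sub>k G\<^sub>i\<^sub>j = (\<Sum>l. G\<^sub>l\<^sub>j \<Gamma>\<^sup>l\<^sub>k\<^sub>i) + (\<Sum>l. G\<^sub>i\<^sub>l \<Gamma>\<^sup>l\<^sub>k\<^sub>j)\<close> splits that term into the two Christoffel corrections
  that complete \<open>V'\<close> and \<open>W'\<close> to covariant derivatives.\<close>

lemma metric_inner_has_derivative:
  fixes G :: "real ^ 'n \<Rightarrow> real ^ 'n ^ 'n::finite"
  assumes S: "open S" "x s \<in> S" "\<And>y. y \<in> S \<Longrightarrow> transpose (G y) = G y"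
    and inv: "invertible (G (x s))" and G: "G differentiable (at (x s))"
    and x: "(x has_vector_derivative x') (at s)"
    and V: "(V has_vector_derivative V') (at s)"
    and W: "(W has_vector_derivative W') (at s)"
  defines "\<Gamma> U \<equiv> \<chi> k. \<Sum>i\<in>UNIV. \<Sum>j\<in>UNIV. christoffel G (x s) k i j * x' $ i * U $ j"
  shows "((\<lambda>t. metric_inner (G (x t)) (V t) (W t)) has_real_derivative
    metric_inner (G (x s)) (V' + \<Gamma> (V s)) (W s) + metric_inner (G (x s)) (V s) (W' + \<Gamma> (W s))) (at s)"
proof -
  let ?C = "christoffel G (x s)"
  define dG where "dG i j = (\<Sum>k\<in>UNIV. x' $ k * partial_deriv k (\<lambda>y. G y $ i $ j) (x s))" for i j
  have comp: "((\<lambda>t. U t $ i) has_real_derivative U' $ i) (at s)"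
    if "(U has_vector_derivative U') (at s)" for U :: "real \<Rightarrow> real ^ 'n" and U' i
    using bounded_linear.has_vector_derivative[OF bounded_linear_vec_nth that]
    by (simp add: has_real_derivative_iff_has_vector_derivative)
  have dGder: "((\<lambda>t. G (x t) $ i $ j) has_real_derivative dG i j) (at s)" for i j
    unfolding dG_def
    by (rule chain_rule_partial_deriv[OF matrix_component_differentiable[OF G] x])
  \<comment> \<open>In each half the summation index of the vector being corrected is exchanged with the index \<open>l\<close>
    that pairs the Christoffel symbol with \<open>G\<close>.\<close>
  have term1: "(\<Sum>i\<in>UNIV. \<Sum>j\<in>UNIV. (\<Sum>k\<in>UNIV. x' $ k * (\<Sum>l\<in>UNIV. G (x s) $ l $ j * ?C l k i)) * V s $ i * W s $ j)
     = metric_inner (G (x s)) (\<Gamma> (V s)) (W s)"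
  proof -
    have "(\<Sum>i\<in>UNIV. \<Sum>j\<in>UNIV. (\<Sum>k\<in>UNIV. x' $ k * (\<Sum>l\<in>UNIV. G (x s) $ l $ j * ?C l k i)) * V s $ i * W s $ j)
      = (\<Sum>i\<in>UNIV. \<Sum>j\<in>UNIV. \<Sum>k\<in>UNIV. \<Sum>l\<in>UNIV. G (x s) $ l $ j * ?C l k i * x' $ k * V s $ i * W s $ j)"
      by (simp add: sum_distrib_left sum_distrib_right mult_ac)
    also have "\<dots> = (\<Sum>i\<in>UNIV. \<Sum>j\<in>UNIV. \<Sum>l\<in>UNIV. \<Sum>k\<in>UNIV. G (x s) $ l $ j * ?C l k i * x' $ k * V s $ i * W s $ j)"
      by (intro sum.cong refl sum.swap)
    also have "\<dots> = (\<Sum>i\<in>UNIV. \<Sum>l\<in>UNIV. \<Sum>j\<in>UNIV. \<Sum>k\<in>UNIV. G (x s) $ l $ j * ?C l k i * x' $ k * V s $ i * W s $ j)"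
      by (intro sum.cong refl sum.swap)
    also have "\<dots> = (\<Sum>l\<in>UNIV. \<Sum>i\<in>UNIV. \<Sum>j\<in>UNIV. \<Sum>k\<in>UNIV. G (x s) $ l $ j * ?C l k i * x' $ k * V s $ i * W s $ j)"
      by (rule sum.swap)
    also have "\<dots> = (\<Sum>l\<in>UNIV. \<Sum>j\<in>UNIV. \<Sum>i\<in>UNIV. \<Sum>k\<in>UNIV. G (x s) $ l $ j * ?C l k i * x' $ k * V s $ i * W s $ j)"
      by (intro sum.cong refl sum.swap)
    also have "\<dots> = (\<Sum>l\<in>UNIV. \<Sum>j\<in>UNIV. \<Sum>k\<in>UNIV. \<Sum>i\<in>UNIV. G (x s) $ l $ j * ?C l k i * x' $ k * V s $ i * W s $ j)"
      by (intro sum.cong refl sum.swap)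
    also have "\<dots> = metric_inner (G (x s)) (\<Gamma> (V s)) (W s)"
      by (simp add: metric_inner_components \<Gamma>_def sum_distrib_left sum_distrib_right mult_ac)
    finally show ?thesis .
  qed
  have term2: "(\<Sum>i\<in>UNIV. \<Sum>j\<in>UNIV. (\<Sum>k\<in>UNIV. x' $ k * (\<Sum>l\<in>UNIV. G (x s) $ i $ l * ?C l k j)) * V s $ i * W s $ j)
     = metric_inner (G (x s)) (V s) (\<Gamma> (W s))"
  proof -
    have "(\<Sum>i\<in>UNIV. \<Sum>j\<in>UNIV. (\<Sum>k\<in>UNIV. x' $ k * (\<Sum>l\<in>UNIV. G (x s) $ i $ l * ?C l k j)) * V s $ i * W s $ j)
      = (\<Sum>i\<in>UNIV. \<Sum>j\<in>UNIV. \<Sum>k\<in>UNIV. \<Sum>l\<in>UNIV. G (x s) $ i $ l * V s $ i * ?C l k j * x' $ k * W s $ j)"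
      by (simp add: sum_distrib_left sum_distrib_right mult_ac)
    also have "\<dots> = (\<Sum>i\<in>UNIV. \<Sum>j\<in>UNIV. \<Sum>l\<in>UNIV. \<Sum>k\<in>UNIV. G (x s) $ i $ l * V s $ i * ?C l k j * x' $ k * W s $ j)"
      by (intro sum.cong refl sum.swap)
    also have "\<dots> = (\<Sum>i\<in>UNIV. \<Sum>l\<in>UNIV. \<Sum>j\<in>UNIV. \<Sum>k\<in>UNIV. G (x s) $ i $ l * V s $ i * ?C l k j * x' $ k * W s $ j)"
      by (intro sum.cong refl sum.swap)
    also have "\<dots> = (\<Sum>i\<in>UNIV. \<Sum>l\<in>UNIV. \<Sum>k\<in>UNIV. \<Sum>j\<in>UNIV. G (x s) $ i $ l * V s $ i * ?C l k j * x' $ k * W s $ j)"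
      by (intro sum.cong refl sum.swap)
    also have "\<dots> = metric_inner (G (x s)) (V s) (\<Gamma> (W s))"
      by (simp add: metric_inner_components \<Gamma>_def sum_distrib_left sum_distrib_right mult_ac)
    finally show ?thesis .
  qed
  have compat: "partial_deriv k (\<lambda>y. G y $ i $ j) (x s) =
    (\<Sum>l\<in>UNIV. G (x s) $ l $ j * ?C l k i) + (\<Sum>l\<in>UNIV. G (x s) $ i $ l * ?C l k j)" for i j k
    by (rule christoffel_metric[where S = S]) (use S inv in auto)
  have "(\<Sum>i\<in>UNIV. \<Sum>j\<in>UNIV. dG i j * V s $ i * W s $ j) =
    metric_inner (G (x s)) (\<Gamma> (V s)) (W s) + metric_inner (G (x s)) (V s) (\<Gamma> (W s))"
    unfolding term1[symmetric] term2[symmetric] dG_def compat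
    by (simp add: distrib_left distrib_right sum.distrib)
  moreover have "((\<lambda>t. metric_inner (G (x t)) (V t) (W t)) has_real_derivative
      (\<Sum>i\<in>UNIV. \<Sum>j\<in>UNIV. dG i j * V s $ i * W s $ j + G (x s) $ i $ j * V' $ i * W s $ j
         + G (x s) $ i $ j * V s $ i * W' $ j)) (at s)"
    unfolding metric_inner_components
    by (rule derivative_eq_intros dGder comp[OF V] comp[OF W] refl | simp add: algebra_simps)+
  ultimately show ?thesis
    by (simp add: metric_inner_add_left metric_inner_add_right sum.distrib
        metric_inner_components[of _ V'] metric_inner_components[of _ _ W'] add_ac)
qed

lemma cov_deriv_metric:
  fixes g :: "('a, 'n::finite) metric"
  assumes M: "riemannian_manifold M \<A> g" and \<alpha>: "smooth_curve M \<A> I \<alpha>"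
    and V: "vector_field_along \<A> I \<alpha> V" and W: "vector_field_along \<A> I \<alpha> W"
    and c: "c \<in> \<A>" and s: "s \<in> I" "\<alpha> s \<in> cdom c"
  shows "((\<lambda>t. metric_inner (g c (coord c (\<alpha> t))) (V c t) (W c t)) has_real_derivative
    metric_inner (g c (coord c (\<alpha> s))) (cov_deriv g \<alpha> V c s) (W c s) +
    metric_inner (g c (coord c (\<alpha> s))) (V c s) (cov_deriv g \<alpha> W c s)) (at s)"
proof -
  have mem: "s \<in> {t \<in> I. \<alpha> t \<in> cdom c}" using s by simp
  have x: "coord c (\<alpha> s) \<in> cimg c" using s by blast
  have op: "open (cimg c)"
    using M c unfolding riemannian_manifold_def smooth_manifold_def by blast
  have sym: "transpose (g c y) = g c y" if "y \<in> cimg c" for y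
    using M c that unfolding riemannian_manifold_def by blast
  have inv: "invertible (g c (coord c (\<alpha> s)))"
  proof (rule invertible_if_pos_def)
    fix u :: "real ^ 'n" assume "u \<noteq> 0"
    then show "metric_inner (g c (coord c (\<alpha> s))) u u > 0"
      using M c x unfolding riemannian_manifold_def by blast
  qed
  have G: "g c differentiable (at (coord c (\<alpha> s)))"
    using M c x smooth_on_imp_differentiable unfolding riemannian_manifold_def by blast
  have "(coord c \<circ> \<alpha>) differentiable (at s)"
    using \<alpha> c mem smooth_on_imp_differentiable unfolding smooth_curve_def by blast
  then have \<alpha>': "((\<lambda>t. coord c (\<alpha> t)) has_vector_derivative velocity \<alpha> c s) (at s)"
    unfolding velocity_def o_def by (simp only: vector_derivative_works)
  have V': "(V c has_vector_derivative vector_derivative (V c) (at s)) (at s)"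
    using V c mem smooth_on_imp_differentiable vector_derivative_works
    unfolding vector_field_along_def by blast
  have W': "(W c has_vector_derivative vector_derivative (W c) (at s)) (at s)"
    using W c mem smooth_on_imp_differentiable vector_derivative_works
    unfolding vector_field_along_def by blast
  show ?thesis
    using metric_inner_has_derivative[where x = "\<lambda>t. coord c (\<alpha> t)", OF op x sym inv G \<alpha>' V' W']
    unfolding cov_deriv_def by simp
qed

section \<open>Frenet equations and harmonic curvatures\<close>

text \<open>Solving the Frenet equation for \<open>a (j + 1)\<close> gives the recursion of the harmonic curvatures,
  started by \<open>a 2 = 0\<close>. The equations have to hold on an open set because each step differentiates
  the identity obtained before.\<close>

lemma frenet_coefficients_harmonic_curvature:
  fixes a :: "nat \<Rightarrow> real \<Rightarrow> real"
  assumes S: "open S" and s: "s \<in> S" and i: "i + 2 \<le> n"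
    and const: "\<And>t. t \<in> S \<Longrightarrow> a 1 t = c"
    and nz: "\<And>j t. 1 \<le> j \<Longrightarrow> j < n \<Longrightarrow> t \<in> S \<Longrightarrow> k j t \<noteq> 0"
    and first: "\<And>t. t \<in> S \<Longrightarrow> (a 1 has_real_derivative k 1 t * a 2 t) (at t)"
    and step: "\<And>j t. 1 < j \<Longrightarrow> j < n \<Longrightarrow> t \<in> S \<Longrightarrow>
      (a j has_real_derivative - k (j - 1) t * a (j - 1) t + k j t * a (j + 1) t) (at t)"
  shows "a (i + 2) s = c * harmonic_curvature k i s"
proof -
  have unique: "D = E" if "\<And>t. t \<in> S \<Longrightarrow> f t = h t" "(f has_real_derivative D) (at t)"
    "(h has_real_derivative E) (at t)" "t \<in> S" for f h :: "real \<Rightarrow> real" and D E t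
    using DERIV_unique has_field_derivative_transform_within_open[OF that(2) S that(4,1)] that(3)
    by blast
  have a2: "a 2 t = 0" if "t \<in> S" "2 \<le> n" for t
  proof -
    have "k 1 t * a 2 t = 0"
      by (rule unique[OF const first[OF that(1)] DERIV_const that(1)])
    then show ?thesis using nz[of 1 t] that by simp
  qed
  show ?thesis using s i
  proof (induction i arbitrary: s rule: less_induct)
    case (less i)
    consider "i = 0" | "i = 1" | m where "i = Suc (Suc m)"
      by (metis One_nat_def not0_implies_Suc)
    then show ?case
    proof cases
      case 1
      then show ?thesis using a2[of s] less.prems by (simp add: numeral_2_eq_2)
    next
      case 2
      have "- k 1 s * a 1 s + k 2 s * a 3 s = 0"
        by (rule unique[OF a2 _ DERIV_const less.prems(1)])
          (use step[of 2 s] less.prems 2 in \<open>simp_all add: numeral_eq_Suc\<close>)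
      then show ?thesis
        using nz[of 2 s] less.prems 2 const[of s] by (simp add: field_simps numeral_eq_Suc)
    next
      case 3
      have eq: "a (m + 3) t = c * harmonic_curvature k (Suc m) t" if "t \<in> S" for t
        using less.IH[of "Suc m" t] less.prems 3 that by (simp add: numeral_eq_Suc)
      have am: "a (m + 2) s = c * harmonic_curvature k m s"
        using less.IH[of m s] less.prems 3 by simp
      let ?D = "- k (m + 2) s * a (m + 2) s + k (m + 3) s * a (m + 4) s"
      have D: "(a (m + 3) has_real_derivative ?D) (at s)"
        using step[of "m + 3" s] less.prems 3 by (simp add: numeral_eq_Suc)
      have cH: "((\<lambda>t. c * harmonic_curvature k (Suc m) t) has_real_derivative ?D) (at s)"
        by (rule has_field_derivative_transform_within_open[OF D S less.prems(1) eq])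
      \<comment> \<open>If \<open>c = 0\<close>, the harmonic curvature may fail to be differentiable at \<open>s\<close>, so that its
        \<open>deriv\<close> is an arbitrary number; but then both sides vanish.\<close>
      have "?D = c * deriv (harmonic_curvature k (Suc m)) s"
      proof (cases "c = 0")
        case True
        then show ?thesis
          using DERIV_unique[OF cH, of 0] by simp
      next
        case False
        have "(harmonic_curvature k (Suc m) has_real_derivative ?D / c) (at s)"
          using DERIV_cdivide[OF cH, of c] False by simp
        then have "deriv (harmonic_curvature k (Suc m)) s = ?D / c"
          by (rule DERIV_imp_deriv)
        then show ?thesis using False by simp
      qed
      then have "k (m + 3) s * a (m + 4) s =
          c * (deriv (harmonic_curvature k (Suc m)) s + k (m + 2) s * harmonic_curvature k m s)"
        unfolding am by (simp add: algebra_simps)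
      moreover have "k (m + 3) s \<noteq> 0" using nz[of "m + 3" s] less.prems 3 by simp
      ultimately have "a (m + 4) s = c * harmonic_curvature k (Suc (Suc m)) s"
        by (simp add: field_simps)
      then show ?thesis using 3 by (simp add: numeral_eq_Suc)
    qed
  qed
qed

theorem theorem3:
  fixes M :: "'a topology"
    and \<A> :: "('a, 'n::finite) chart set"
    and g :: "('a, 'n) metric"
    and \<alpha> :: "real \<Rightarrow> 'a"
    and I :: "real set"
    and v :: "nat \<Rightarrow> ('a, 'n) field_along"
    and k :: "nat \<Rightarrow> real \<Rightarrow> real"
  assumes "CARD('n) \<ge> 3"
    and "(\<exists>\<kappa>. space_form M \<A> g \<kappa>) \<or> (\<exists>f. euclidean_hypersurface M \<A> g f)"
    and "nondegenerate_curve M \<A> g I \<alpha> v k"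
    and "lc_helix \<A> g I \<alpha>"
  shows "(\<lambda>s. \<Sum>i = 1..CARD('n) - 2. (harmonic_curvature k i s)\<^sup>2) constant_on I"
proof -
  let ?n = "CARD('n)"
  have M: "riemannian_manifold M \<A> g"
    using assms(2) unfolding space_form_def euclidean_hypersurface_def by blast
  have \<alpha>: "smooth_curve M \<A> I \<alpha>"
    using assms(3) unfolding nondegenerate_curve_def unit_speed_curve_def by blast
  have v: "vector_field_along \<A> I \<alpha> (v i)" if "i \<in> {1..?n}" for i
    using assms(3) that unfolding nondegenerate_curve_def by blast
  obtain X \<phi> where X: "vector_field_along \<A> I \<alpha> X"
    and parallel: "field_eq \<A> I \<alpha> (cov_deriv g \<alpha> X) (\<lambda>c s. 0)"
    and unit: "field_inner_eq \<A> g I \<alpha> X X (\<lambda>s. 1)"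
    and angle: "field_inner_eq \<A> g I \<alpha> (velocity \<alpha>) X (\<lambda>s. cos \<phi>)"
    using assms(4) unfolding lc_helix_def lc_helix_axis_def lc_parallel_def by blast
  have "(\<Sum>i = 1..?n - 2. (harmonic_curvature k i s)\<^sup>2) = 1 / (cos \<phi>)\<^sup>2 - 1" if s: "s \<in> I" for s
  proof -
    have cont: "continuous_map (top_of_set I) M \<alpha>" and oI: "open I"
      using \<alpha> unfolding smooth_curve_def by blast+
    have "\<alpha> s \<in> topspace M"
      using continuous_map_image_subset_topspace[OF cont] s by auto
    then obtain c where c: "c \<in> \<A>" "\<alpha> s \<in> cdom c"
      using M unfolding riemannian_manifold_def smooth_manifold_def by auto
    define S where "S = {t \<in> I. \<alpha> t \<in> cdom c}"
    have "openin M (cdom c)"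
      using M c unfolding riemannian_manifold_def smooth_manifold_def by blast
    then have "openin (top_of_set I) {t \<in> I. \<alpha> t \<in> cdom c}"
      using openin_continuous_map_preimage[OF cont] by simp
    then have S: "open S" unfolding S_def using oI openin_open_trans by blast
    have sS: "s \<in> S" using s c by (simp add: S_def)
    define G where "G t = g c (coord c (\<alpha> t))" for t
    define a where "a i t = metric_inner (G t) (v i c t) (X c t)" for i t
    have deriv: "(a i has_real_derivative metric_inner (G t) (cov_deriv g \<alpha> (v i) c t) (X c t)) (at t)"
      if "i \<in> {1..?n}" "t \<in> S" for i t
    proof -
      have t: "t \<in> I" "\<alpha> t \<in> cdom c" using that by (auto simp: S_def)
      then have "cov_deriv g \<alpha> X c t = 0" using parallel c unfolding field_eq_def by blast
      then show ?thesis
        using cov_deriv_metric[OF M \<alpha> v[OF that(1)] X c(1) t]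
        by (simp add: a_def[abs_def] G_def metric_inner_zero_right)
    qed
    have a1: "a 1 t = cos \<phi>" if "t \<in> S" for t
    proof -
      have t: "t \<in> I" "\<alpha> t \<in> cdom c" using that by (auto simp: S_def)
      then have "v 1 c t = velocity \<alpha> c t"
        using assms(3) c unfolding nondegenerate_curve_def field_eq_def by blast
      then show ?thesis using angle c t unfolding field_inner_eq_def a_def G_def by simp
    qed
    have nz: "k j t \<noteq> 0" if "1 \<le> j" "j < ?n" "t \<in> S" for j t
      using assms(3) that unfolding nondegenerate_curve_def S_def by auto
    have first: "(a 1 has_real_derivative k 1 t * a 2 t) (at t)" if "t \<in> S" for t
    proof -
      have "cov_deriv g \<alpha> (v 1) c t = k 1 t *\<^sub>R v 2 c t"
        using assms(3) that c unfolding nondegenerate_curve_def field_eq_def S_def by blast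
      then show ?thesis
        using deriv[of 1 t] that assms(1) by (simp add: metric_inner_scaleR_left a_def)
    qed
    have step: "(a j has_real_derivative - k (j - 1) t * a (j - 1) t + k j t * a (j + 1) t) (at t)"
      if "1 < j" "j < ?n" "t \<in> S" for j t
    proof -
      have "cov_deriv g \<alpha> (v j) c t = - k (j - 1) t *\<^sub>R v (j - 1) c t + k j t *\<^sub>R v (j + 1) c t"
        using assms(3) that c unfolding nondegenerate_curve_def field_eq_def S_def by blast
      then show ?thesis
        using deriv[of j t] that
        by (simp only: metric_inner_add_left metric_inner_scaleR_left a_def) simp
    qed
    have harmonic: "a (i + 2) s = cos \<phi> * harmonic_curvature k i s" if "i + 2 \<le> ?n" for i
      by (rule frenet_coefficients_harmonic_curvature[where S = S and n = ?n])
        (use S sS that a1 nz first step in auto)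
    have a2: "a 2 s = 0" using harmonic[of 0] assms(1) by (simp add: numeral_2_eq_2)
    have "1 = metric_inner (G s) (X c s) (X c s)"
      using unit c s unfolding field_inner_eq_def G_def by simp
    also have "\<dots> = (\<Sum>i = 1..?n. (a i s)\<^sup>2)"
      unfolding a_def
    proof (rule metric_inner_parseval)
      show "transpose (G s) = G s"
        using M c unfolding riemannian_manifold_def G_def by blast
      show "metric_inner (G s) (v i c s) (v j c s) = (if i = j then 1 else 0)"
        if "i \<in> {1..?n}" "j \<in> {1..?n}" for i j
        using assms(3) that c s unfolding nondegenerate_curve_def field_inner_eq_def G_def by blast
    qed simp_all
    also have "\<dots> = (a 1 s)\<^sup>2 + (a 2 s)\<^sup>2 + (\<Sum>i = 3..?n. (a i s)\<^sup>2)"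
      using assms(1) by (simp add: sum.atLeast_Suc_atMost numeral_eq_Suc)
    also have "{3..?n} = {1 + 2..(?n - 2) + 2}"
      using assms(1) by auto
    also have "(\<Sum>i = 1 + 2..(?n - 2) + 2. (a i s)\<^sup>2) = (\<Sum>i = 1..?n - 2. (a (i + 2) s)\<^sup>2)"
      by (rule sum.shift_bounds_cl_nat_ivl)
    also have "\<dots> = (cos \<phi>)\<^sup>2 * (\<Sum>i = 1..?n - 2. (harmonic_curvature k i s)\<^sup>2)"
      unfolding sum_distrib_left power_mult_distrib[symmetric]
      by (rule sum.cong[OF refl], subst harmonic) (use assms(1) in auto)
    finally have eq: "1 = (cos \<phi>)\<^sup>2 * (1 + (\<Sum>i = 1..?n - 2. (harmonic_curvature k i s)\<^sup>2))"
      using a1[OF sS] a2 by (simp add: algebra_simps)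
    then have "(cos \<phi>)\<^sup>2 \<noteq> 0" by auto
    then show ?thesis using eq by (simp add: field_simps)
  qed
  then show ?thesis unfolding constant_on_def by blast
qed

end
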